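(* Let $f \in \mathbb{C}[x_1,\ldots,x_n]_d$ be a homogeneous polynomial of degree $d$ and let $\mathcal{A}_f$ be its apolar algebra. Then $$\mathbf{R}(\mathcal{A}_f) \le (3d+1)\,\mathbf{R}_S(f).$$
   Context: Let $\mathcal{R}^n=\mathbb{C}[\partial_1,\ldots,\partial_n]$ act on $\mathbb{C}[x_1,\ldots,x_n]$ by differentiation ($\partial_i$ acts as $\partial/\partial x_i$), written $h\circ f$. $\mathrm{Ann}(f)=\{h\in\mathcal{R}^n : h\circ f=0\}$, and the apolar algebra is $\mathcal{A}_f=\mathcal{R}^n/\mathrm{Ann}(f)$, a finite-dimensional commutative unital $\mathbb{C}$-algebra. For a finite-dimensional algebra $A$ with basis $e_1,\ldots,e_m$, its structure tensor is $\sum_{i,j} e_i\otimes e_j\otimes (e_ie_j)\in A\otimes A\otimes A$, and $\mathbf{R}(A)$ denotes the tensor rank of this tensor (the minimum number of simple tensors $u\otimes v\otimes w$ summing to it). The Waring rank $\mathbf{R}_S(f)$ is the minimum $r$ such that $f=\sum_{i=1}^r c_i\ell_i^d$ for linear forms $\ell_i$ and scalars $c_i$. *)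

theory Defs
  imports
    "HOL-Library.Poly_Mapping"
    "HOL-Library.Extended_Nat"
    "HOL-Algebra.QuotRing"
    "Jordan_Normal_Form.VS_Connect"
begin

section \<open>Polynomials in finitely many variables\<close>

text \<open>
  A monomial is its exponent vector, so \<open>Poly_Mapping.single m c\<close> is the term \<open>c x\<^sup>m\<close>, and
  \<open>Poly_Mapping.single 0 c\<close> is the constant \<open>c\<close>. The number of variables is \<open>n = CARD('n)\<close>.
  The same type serves for the ring acted upon and for the ring of differential operators,
  whose variables are the \<open>\<partial>\<^sub>i\<close>.
\<close>

type_synonym 'n mvpoly = "('n \<Rightarrow>\<^sub>0 nat) \<Rightarrow>\<^sub>0 complex"

definition mv_var :: "'n \<Rightarrow> 'n mvpoly" where
  "mv_var i = Poly_Mapping.single (Poly_Mapping.single i 1) 1"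

definition homogeneous :: "nat \<Rightarrow> 'n::finite mvpoly \<Rightarrow> bool" where
  "homogeneous d f \<longleftrightarrow> (\<forall>m \<in> Poly_Mapping.keys f. (\<Sum>i\<in>UNIV. Poly_Mapping.lookup m i) = d)"

definition waring_rank :: "nat \<Rightarrow> 'n::finite mvpoly \<Rightarrow> enat" where
  "waring_rank d f = Inf {enat r | r. \<exists>(c :: nat \<Rightarrow> complex) (l :: nat \<Rightarrow> 'n mvpoly).
     (\<forall>i<r. homogeneous 1 (l i)) \<and> f = (\<Sum>i<r. Poly_Mapping.single 0 (c i) * l i ^ d)}"


section \<open>The apolar algebra\<close>

text \<open>Where \<open>m\<^sub>i = 0\<close> the truncated exponent is harmless, as the coefficient vanishes.\<close>

definition partial :: "'n \<Rightarrow> 'n mvpoly \<Rightarrow> 'n mvpoly" where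
  "partial i f = (\<Sum>m \<in> Poly_Mapping.keys f.
     Poly_Mapping.single (m - Poly_Mapping.single i 1)
       (of_nat (Poly_Mapping.lookup m i) * Poly_Mapping.lookup f m))"

text \<open>The fold is well defined because partial derivatives commute (see \<open>partial_commute\<close>).\<close>

definition partial_monom :: "('n \<Rightarrow>\<^sub>0 nat) \<Rightarrow> 'n mvpoly \<Rightarrow> 'n mvpoly" where
  "partial_monom a f =
     Finite_Set.fold (\<lambda>i. partial i ^^ Poly_Mapping.lookup a i) f (Poly_Mapping.keys a)"

definition diff_act :: "'n mvpoly \<Rightarrow> 'n mvpoly \<Rightarrow> 'n mvpoly" (infixr \<open>\<circ>\<^sub>\<partial>\<close> 75) where
  "h \<circ>\<^sub>\<partial> f = (\<Sum>a \<in> Poly_Mapping.keys h.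
     Poly_Mapping.single 0 (Poly_Mapping.lookup h a) * partial_monom a f)"

definition Ann :: "'n mvpoly \<Rightarrow> 'n mvpoly set" where
  "Ann f = {h. h \<circ>\<^sub>\<partial> f = 0}"

text \<open>The scalar action on the quotient ring is multiplication by the class of a constant.\<close>

definition apolar_algebra :: "'n mvpoly \<Rightarrow> (complex, 'n mvpoly set) module" where
  "apolar_algebra f = (let Q = class_ring Quot Ann f in
     \<lparr> carrier = carrier Q, mult = mult Q, one = one Q, zero = zero Q, add = add Q,
       smult = (\<lambda>c X. (Ann f +>\<^bsub>class_ring\<^esub> Poly_Mapping.single 0 c) \<otimes>\<^bsub>Q\<^esub> X) \<rparr>)"


section \<open>Tensor rank and the rank of an algebra\<close>

text \<open>
  \<open>V \<otimes> V \<otimes> V\<close> is the free vector space on the triples of vectors modulo the subspace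
  \<open>trilinear_rel V\<close> generated by the trilinearity relations. Tensors are given by
  representatives in the free space, and \<open>s\<close>, \<open>t\<close> represent the same tensor iff
  \<open>s - t \<in> trilinear_rel V\<close>.
\<close>

type_synonym 'v tensor3 = "('v \<times> 'v \<times> 'v) \<Rightarrow>\<^sub>0 complex"

definition simple_tensor :: "'v \<Rightarrow> 'v \<Rightarrow> 'v \<Rightarrow> 'v tensor3" where
  "simple_tensor u v w = Poly_Mapping.single (u, v, w) 1"

definition scale_tensor :: "complex \<Rightarrow> 'v tensor3 \<Rightarrow> 'v tensor3" where
  "scale_tensor c t = Poly_Mapping.map ((*) c) t"

inductive_set trilinear_rel :: "(complex, 'v) module \<Rightarrow> 'v tensor3 set"
  for V :: "(complex, 'v) module" where
  zero: "0 \<in> trilinear_rel V"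
| add: "s \<in> trilinear_rel V \<Longrightarrow> t \<in> trilinear_rel V \<Longrightarrow> s + t \<in> trilinear_rel V"
| scale: "t \<in> trilinear_rel V \<Longrightarrow> scale_tensor c t \<in> trilinear_rel V"
| add1: "\<lbrakk>u \<in> carrier V; u' \<in> carrier V; v \<in> carrier V; w \<in> carrier V\<rbrakk> \<Longrightarrow>
    simple_tensor (u \<oplus>\<^bsub>V\<^esub> u') v w - (simple_tensor u v w + simple_tensor u' v w) \<in> trilinear_rel V"
| add2: "\<lbrakk>u \<in> carrier V; v \<in> carrier V; v' \<in> carrier V; w \<in> carrier V\<rbrakk> \<Longrightarrow>
    simple_tensor u (v \<oplus>\<^bsub>V\<^esub> v') w - (simple_tensor u v w + simple_tensor u v' w) \<in> trilinear_rel V"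
| add3: "\<lbrakk>u \<in> carrier V; v \<in> carrier V; w \<in> carrier V; w' \<in> carrier V\<rbrakk> \<Longrightarrow>
    simple_tensor u v (w \<oplus>\<^bsub>V\<^esub> w') - (simple_tensor u v w + simple_tensor u v w') \<in> trilinear_rel V"
| smult1: "\<lbrakk>u \<in> carrier V; v \<in> carrier V; w \<in> carrier V\<rbrakk> \<Longrightarrow>
    simple_tensor (c \<odot>\<^bsub>V\<^esub> u) v w - scale_tensor c (simple_tensor u v w) \<in> trilinear_rel V"
| smult2: "\<lbrakk>u \<in> carrier V; v \<in> carrier V; w \<in> carrier V\<rbrakk> \<Longrightarrow>
    simple_tensor u (c \<odot>\<^bsub>V\<^esub> v) w - scale_tensor c (simple_tensor u v w) \<in> trilinear_rel V"
| smult3: "\<lbrakk>u \<in> carrier V; v \<in> carrier V; w \<in> carrier V\<rbrakk> \<Longrightarrow>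
    simple_tensor u v (c \<odot>\<^bsub>V\<^esub> w) - scale_tensor c (simple_tensor u v w) \<in> trilinear_rel V"

definition tensor_eq :: "(complex, 'v) module \<Rightarrow> 'v tensor3 \<Rightarrow> 'v tensor3 \<Rightarrow> bool" where
  "tensor_eq V s t \<longleftrightarrow> s - t \<in> trilinear_rel V"

definition tensor_rank :: "(complex, 'v) module \<Rightarrow> 'v tensor3 \<Rightarrow> enat" where
  "tensor_rank V t = Inf {enat r | r. \<exists>u v w :: nat \<Rightarrow> 'v.
     (\<forall>i<r. u i \<in> carrier V \<and> v i \<in> carrier V \<and> w i \<in> carrier V) \<and>
     tensor_eq V t (\<Sum>i<r. simple_tensor (u i) (v i) (w i))}"

definition structure_tensor :: "(complex, 'v) module \<Rightarrow> 'v set \<Rightarrow> 'v tensor3" where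
  "structure_tensor A B = (\<Sum>a\<in>B. \<Sum>b\<in>B. simple_tensor a b (a \<otimes>\<^bsub>A\<^esub> b))"

text \<open>
  The structure tensor depends on the basis, its rank does not: a change of basis acts on
  it by an invertible linear map on the first two tensor factors.
\<close>

definition algebra_rank :: "(complex, 'v) module \<Rightarrow> enat" where
  "algebra_rank A = tensor_rank A
     (structure_tensor A (SOME B. finite B \<and> vectorspace.basis class_ring A B))"


section \<open>The polynomial action and the algebra structure of the quotient\<close>

lemma lookup_partial:
  "Poly_Mapping.lookup (partial i f) m =
     of_nat (Poly_Mapping.lookup m i + 1) * Poly_Mapping.lookup f (m + Poly_Mapping.single i 1)"
proof -
  let ?e = "Poly_Mapping.single i (1::nat)"
  let ?g = "\<lambda>k. of_nat (Poly_Mapping.lookup k i) * Poly_Mapping.lookup f k"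
  have eq: "(?g k when k - ?e = m) = (if k = m + ?e then ?g k else 0)" for k
  proof (cases "Poly_Mapping.lookup k i = 0")
    case True
    then have "k \<noteq> m + ?e" by (auto simp: lookup_add)
    with True show ?thesis by (simp add: when_def)
  next
    case False
    then have "k - ?e + ?e = k"
      by (intro poly_mapping_eqI) (auto simp: lookup_add lookup_minus lookup_single when_def)
    then have "k - ?e = m \<longleftrightarrow> k = m + ?e" by auto
    then show ?thesis by (simp add: when_def)
  qed
  have "Poly_Mapping.lookup (partial i f) m = (\<Sum>k\<in>Poly_Mapping.keys f. ?g k when k - ?e = m)"
    by (simp add: partial_def lookup_sum lookup_single)
  also have "\<dots> = (if m + ?e \<in> Poly_Mapping.keys f then ?g (m + ?e) else 0)"
    by (simp only: eq) (simp add: sum.delta)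
  also have "\<dots> = ?g (m + ?e)" by (simp add: in_keys_iff)
  finally show ?thesis by (simp add: lookup_add)
qed

lemma partial_commute: "partial i (partial j f) = partial j (partial i f)"
  by (cases "i = j")
     (auto intro!: poly_mapping_eqI simp: lookup_partial lookup_add lookup_single add_ac)

lemma lookup_partial_power:
  "Poly_Mapping.lookup ((partial i ^^ k) f) m =
     pochhammer (of_nat (Poly_Mapping.lookup m i + 1)) k *
     Poly_Mapping.lookup f (m + Poly_Mapping.single i k)"
proof (induction k arbitrary: m)
  case (Suc k)
  have "m + Poly_Mapping.single i 1 + Poly_Mapping.single i k = m + Poly_Mapping.single i (Suc k)"
    by (simp add: add.assoc single_add[symmetric])
  then show ?case
    by (simp add: Suc lookup_partial pochhammer_rec lookup_add lookup_single add_ac)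
qed simp

lemma partial_power_commute:
  "(partial i ^^ k) ((partial j ^^ l) f) = (partial j ^^ l) ((partial i ^^ k) f)"
  by (cases "i = j")
     (auto intro!: poly_mapping_eqI simp: lookup_partial_power lookup_add lookup_single add_ac
       simp flip: funpow_add[THEN fun_cong, unfolded o_apply])

lemma lookup_partial_monom:
  "Poly_Mapping.lookup (partial_monom a f) m =
     (\<Prod>i\<in>Poly_Mapping.keys a. pochhammer (of_nat (Poly_Mapping.lookup m i + 1)) (Poly_Mapping.lookup a i)) *
     Poly_Mapping.lookup f (m + a)"
proof -
  interpret comp_fun_commute "\<lambda>i. partial i ^^ Poly_Mapping.lookup a i"
    by standard (auto simp: fun_eq_iff partial_power_commute)
  have "Poly_Mapping.lookup (Finite_Set.fold (\<lambda>i. partial i ^^ Poly_Mapping.lookup a i) f S) m =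
     (\<Prod>i\<in>S. pochhammer (of_nat (Poly_Mapping.lookup m i + 1)) (Poly_Mapping.lookup a i)) *
     Poly_Mapping.lookup f (m + (\<Sum>i\<in>S. Poly_Mapping.single i (Poly_Mapping.lookup a i)))"
    if "finite S" for S using that
  proof (induction S arbitrary: m rule: finite_induct)
    case (insert x S)
    have "(\<Prod>i\<in>S. pochhammer (of_nat (Poly_Mapping.lookup (m + Poly_Mapping.single x (Poly_Mapping.lookup a x)) i + 1)) (Poly_Mapping.lookup a i))
       = (\<Prod>i\<in>S. pochhammer (of_nat (Poly_Mapping.lookup m i + 1)) (Poly_Mapping.lookup a i) :: complex)"
      using insert.hyps by (intro prod.cong) (auto simp: lookup_add lookup_single when_def)
    with insert show ?case
      by (simp add: lookup_partial_power add_ac mult_ac)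
  qed simp
  moreover have "(\<Sum>i\<in>Poly_Mapping.keys a. Poly_Mapping.single i (Poly_Mapping.lookup a i)) = a"
    by (intro poly_mapping_eqI) (auto simp: lookup_sum lookup_single when_def in_keys_iff)
  ultimately show ?thesis
    by (simp add: partial_monom_def)
qed


lemma partial_monom_single: "partial_monom (Poly_Mapping.single i 1) f = partial i f"
  by (rule poly_mapping_eqI) (simp add: lookup_partial_monom lookup_partial)

lemma partial_monom_add: "partial_monom (a + b) f = partial_monom a (partial_monom b f)"
proof (rule poly_mapping_eqI)
  fix m
  let ?S = "Poly_Mapping.keys a \<union> Poly_Mapping.keys b"
  have *: "Poly_Mapping.lookup (partial_monom c g) k =
      (\<Prod>i\<in>?S. pochhammer (of_nat (Poly_Mapping.lookup k i + 1)) (Poly_Mapping.lookup c i)) *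
      Poly_Mapping.lookup g (k + c)" if "Poly_Mapping.keys c \<subseteq> ?S" for c g k
    unfolding lookup_partial_monom using that
    by (intro arg_cong2[of _ _ _ _ "(*)"] prod.mono_neutral_left) (auto simp: in_keys_iff)
  show "Poly_Mapping.lookup (partial_monom (a + b) f) m =
      Poly_Mapping.lookup (partial_monom a (partial_monom b f)) m"
    using Poly_Mapping.keys_add[of a b]
    by (simp add: * pochhammer_product' lookup_add prod.distrib add_ac)
qed

lemma lookup_const_mult:
  "Poly_Mapping.lookup (Poly_Mapping.single 0 c * (f :: 'n mvpoly)) m = c * Poly_Mapping.lookup f m"
proof -
  have "Poly_Mapping.map ((*) c) f = Poly_Mapping.single 0 c * f"
    by (rule mult_map_scale_conv_mult)
  then have "Poly_Mapping.lookup (Poly_Mapping.single 0 c * f) m =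
      Poly_Mapping.lookup (Poly_Mapping.map ((*) c) f) m" by simp
  also have "\<dots> = c * Poly_Mapping.lookup f m" by (simp add: Poly_Mapping.map.rep_eq when_def)
  finally show ?thesis .
qed

lemma partial_monom_plus: "partial_monom a (f + g) = partial_monom a f + partial_monom a g"
  by (rule poly_mapping_eqI) (simp add: lookup_partial_monom lookup_add algebra_simps)

lemma partial_monom_const_mult:
  "partial_monom a (Poly_Mapping.single 0 c * f) = Poly_Mapping.single 0 c * partial_monom a f"
  by (rule poly_mapping_eqI) (simp add: lookup_partial_monom lookup_const_mult)

lemma diff_act_superset:
  assumes "finite S" "Poly_Mapping.keys h \<subseteq> S"
  shows "h \<circ>\<^sub>\<partial> f =
    (\<Sum>a\<in>S. Poly_Mapping.single 0 (Poly_Mapping.lookup h a) * partial_monom a f)"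
  unfolding diff_act_def using assms
  by (intro sum.mono_neutral_left) (auto simp: in_keys_iff)

lemma diff_act_single:
  "Poly_Mapping.single a c \<circ>\<^sub>\<partial> f = Poly_Mapping.single 0 c * partial_monom a f"
  by (subst diff_act_superset[of "{a}"]) auto

lemma diff_act_zero_left: "0 \<circ>\<^sub>\<partial> f = 0"
  by (simp add: diff_act_def)

lemma diff_act_add_left: "(h + k) \<circ>\<^sub>\<partial> f = h \<circ>\<^sub>\<partial> f + k \<circ>\<^sub>\<partial> f"
proof -
  let ?S = "Poly_Mapping.keys h \<union> Poly_Mapping.keys k"
  have "g \<circ>\<^sub>\<partial> f = (\<Sum>a\<in>?S. Poly_Mapping.single 0 (Poly_Mapping.lookup g a) * partial_monom a f)"
    if "Poly_Mapping.keys g \<subseteq> ?S" for g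
    using that by (intro diff_act_superset) auto
  then show ?thesis
    using Poly_Mapping.keys_add[of h k]
    by (simp add: lookup_add single_add algebra_simps sum.distrib)
qed

lemma diff_act_add_right: "h \<circ>\<^sub>\<partial> (f + g) = h \<circ>\<^sub>\<partial> f + h \<circ>\<^sub>\<partial> g"
  by (simp add: diff_act_def partial_monom_plus algebra_simps sum.distrib)

lemma diff_act_const_mult_right:
  "h \<circ>\<^sub>\<partial> (Poly_Mapping.single 0 c * f) = Poly_Mapping.single 0 c * (h \<circ>\<^sub>\<partial> f)"
  unfolding diff_act_def partial_monom_const_mult sum_distrib_left by (simp only: mult.left_commute)

lemma mvpoly_induct:
  fixes h :: "'n mvpoly"
  assumes "P 0" and "\<And>a c h. P h \<Longrightarrow> P (Poly_Mapping.single a c + h)"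
  shows "P h"
proof -
  have "P (\<Sum>a\<in>S. Poly_Mapping.single a (Poly_Mapping.lookup h a))" if "finite S" for S
    using that by induction (auto intro: assms)
  moreover have "(\<Sum>a\<in>Poly_Mapping.keys h. Poly_Mapping.single a (Poly_Mapping.lookup h a)) = h"
    by (intro poly_mapping_eqI) (auto simp: lookup_sum lookup_single when_def in_keys_iff)
  ultimately show ?thesis by (metis finite_keys)
qed

lemma diff_act_var: "mv_var i \<circ>\<^sub>\<partial> f = partial i f"
  unfolding mv_var_def diff_act_single partial_monom_single by simp

lemma diff_act_one: "1 \<circ>\<^sub>\<partial> f = f"
  using diff_act_single[of 0 1 f] by (simp add: partial_monom_def)

lemma diff_act_mult: "(h * k) \<circ>\<^sub>\<partial> f = h \<circ>\<^sub>\<partial> (k \<circ>\<^sub>\<partial> f)"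
proof (induction h rule: mvpoly_induct)
  case (2 a c h)
  have "(Poly_Mapping.single a c * k) \<circ>\<^sub>\<partial> f = Poly_Mapping.single a c \<circ>\<^sub>\<partial> (k \<circ>\<^sub>\<partial> f)"
  proof (induction k rule: mvpoly_induct)
    case 1
    show ?case using diff_act_const_mult_right[of _ 0] by (simp add: diff_act_zero_left)
  next
    case (2 b e k)
    then show ?case
      by (simp add: distrib_left diff_act_add_left diff_act_add_right mult_single diff_act_single
        partial_monom_add partial_monom_const_mult partial_monom_plus)
         (simp add: mult.assoc[symmetric] mult_single)
  qed
  with 2 show ?case by (simp add: distrib_right diff_act_add_left)
qed (simp add: diff_act_zero_left)

lemma Ann_ideal: "ideal (Ann f) class_ring"
proof (rule idealI)
  show "ring (class_ring :: 'a mvpoly ring)" by (rule class_ring.ring_axioms)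
  have zero: "h \<circ>\<^sub>\<partial> 0 = 0" for h :: "'a mvpoly"
    using diff_act_const_mult_right[of h 0 0] by simp
  show "subgroup (Ann f) (add_monoid class_ring)"
  proof (rule group.subgroupI)
    show "Group.group (add_monoid (class_ring :: 'a mvpoly ring))"
      by (rule abelian_group.a_group) (rule ring.is_abelian_group, rule class_ring.ring_axioms)
    fix h assume "h \<in> Ann f"
    then have "(- 1 * h) \<circ>\<^sub>\<partial> f = 0" unfolding Ann_def diff_act_mult by (simp add: zero)
    then have "- h \<in> Ann f" by (simp add: Ann_def)
    moreover have "inv\<^bsub>add_monoid class_ring\<^esub> h = - h"
      unfolding a_inv_def[symmetric] by (simp add: class_ring_simps)
    ultimately show "inv\<^bsub>add_monoid class_ring\<^esub> h \<in> Ann f" by simp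
  qed (use diff_act_zero_left[of f] in \<open>auto simp: Ann_def diff_act_add_left\<close>)
  show "x \<otimes>\<^bsub>class_ring\<^esub> a \<in> Ann f" "a \<otimes>\<^bsub>class_ring\<^esub> x \<in> Ann f"
    if "a \<in> Ann f" "x \<in> carrier class_ring" for a x
    using that by (auto simp: Ann_def diff_act_mult zero mult.commute[of a x])
qed

lemma apolar_algebra_is_algebra: "algebra class_ring (apolar_algebra f)"
proof -
  interpret I: ideal "Ann f" class_ring by (rule Ann_ideal)
  let ?Q = "class_ring Quot Ann f"
  interpret Q: cring ?Q by (rule I.quotient_is_cring) (rule class_cring.cring_axioms)
  interpret h: ring_hom_ring class_ring ?Q "(+>\<^bsub>class_ring\<^esub>) (Ann f)"
    by (rule I.rcos_ring_hom_ring)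
  let ?k = "\<lambda>c. Ann f +>\<^bsub>class_ring\<^esub> Poly_Mapping.single 0 c"
  have k: "?k c \<in> carrier ?Q" "?k (c + e) = ?k c \<oplus>\<^bsub>?Q\<^esub> ?k e" "?k (c * e) = ?k c \<otimes>\<^bsub>?Q\<^esub> ?k e"
    "Ann f +>\<^bsub>class_ring\<^esub> 1 = \<one>\<^bsub>?Q\<^esub>" for c e
    using h.hom_closed h.hom_add[of "Poly_Mapping.single 0 c" "Poly_Mapping.single 0 e"]
      h.hom_mult[of "Poly_Mapping.single 0 c" "Poly_Mapping.single 0 e"] h.hom_one
    by (simp_all add: single_add mult_single)
  show ?thesis
  proof (rule algebraI)
    show "cring (class_ring :: complex ring)" by (rule class_cring.cring_axioms)
    show "cring (apolar_algebra f)"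
    proof (intro cringI abelian_groupI comm_monoidI)
      fix X assume "X \<in> carrier (apolar_algebra f)"
      then have "\<ominus>\<^bsub>?Q\<^esub> X \<in> carrier ?Q" "\<ominus>\<^bsub>?Q\<^esub> X \<oplus>\<^bsub>?Q\<^esub> X = \<zero>\<^bsub>?Q\<^esub>"
        by (simp_all add: apolar_algebra_def Let_def Q.l_neg)
      then show "\<exists>Y\<in>carrier (apolar_algebra f). Y \<oplus>\<^bsub>apolar_algebra f\<^esub> X = \<zero>\<^bsub>apolar_algebra f\<^esub>"
        by (auto simp: apolar_algebra_def Let_def)
    qed ((simp add: apolar_algebra_def Let_def Q.m_assoc Q.a_assoc Q.l_distr; fail) |
          (simp add: apolar_algebra_def Let_def Q.m_comm Q.a_comm; fail))+
  qed (simp_all add: apolar_algebra_def Let_def k Q.m_assoc Q.l_distr Q.r_distr)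
qed

end

theory Submission
  imports Defs
begin

text \<open>
  Write \<open>f = \<Sum>\<^sub>j c\<^sub>j l\<^sub>j\<^sup>d\<close> with \<open>r\<close> summands, and let \<open>p\<^sub>j\<close> be the coefficient vector of \<open>l\<^sub>j\<close>.
  For an operator \<open>h\<close>, the polynomial \<open>h \<circ> l\<^sub>j\<^sup>d\<close> depends only, and linearly, on the restriction
  \<open>h (t p\<^sub>j)\<close> of \<open>h\<close> to a line. If \<open>g\<close> and \<open>h\<close> represent classes of the apolar algebra, they can
  be taken of degree at most \<open>d\<close>; the restriction of \<open>g h\<close> then has degree at most \<open>2 d\<close> and is
  interpolated from its values \<open>g (x p\<^sub>j) h (x p\<^sub>j)\<close> at \<open>2 d + 1\<close> points \<open>x\<close>. So \<open>(g h) \<circ> f\<close>, and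
  with it the class of \<open>g h\<close>, is a sum of \<open>(2 d + 1) r\<close> fixed vectors, each multiplied by a linear
  form in \<open>g\<close> and a linear form in \<open>h\<close>.
\<close>

section \<open>Tensor rank\<close>

lemma lookup_scale_tensor:
  "Poly_Mapping.lookup (scale_tensor c t) k = c * Poly_Mapping.lookup t k"
  by (simp add: scale_tensor_def Poly_Mapping.map.rep_eq when_def)

interpretation tensor: vector_space "scale_tensor :: complex \<Rightarrow> 'v tensor3 \<Rightarrow> 'v tensor3"
  by unfold_locales
    (rule poly_mapping_eqI, simp add: lookup_scale_tensor lookup_add algebra_simps)+

lemma subspace_trilinear_rel: "tensor.subspace (trilinear_rel V)"
  by (simp add: tensor.subspace_def trilinear_rel.zero trilinear_rel.add trilinear_rel.scale)

lemma tensor_eq_sym: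
  assumes "tensor_eq V s t"
  shows "tensor_eq V t s"
  using tensor.subspace_neg[OF subspace_trilinear_rel] assms by (fastforce simp: tensor_eq_def)

lemma tensor_eq_trans [trans]:
  assumes "tensor_eq V s t" and "tensor_eq V t u"
  shows "tensor_eq V s u"
  using trilinear_rel.add[of "s - t" V "t - u"] assms by (simp add: tensor_eq_def)

lemma tensor_eq_scale_tensor:
  assumes "tensor_eq V s t"
  shows "tensor_eq V (scale_tensor c s) (scale_tensor c t)"
  using trilinear_rel.scale[of "s - t" V c] assms
  by (simp add: tensor_eq_def tensor.scale_right_diff_distrib)

lemma tensor_eq_add:
  assumes "tensor_eq V s t" and "tensor_eq V s' t'"
  shows "tensor_eq V (s + s') (t + t')"
  using trilinear_rel.add[of "s - t" V "s' - t'"] assms by (simp add: tensor_eq_def add_diff_add)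

lemma tensor_eq_sum:
  assumes "\<And>x. x \<in> S \<Longrightarrow> tensor_eq V (g x) (h x)"
  shows "tensor_eq V (sum g S) (sum h S)"
  using tensor.subspace_sum[OF subspace_trilinear_rel, of S "\<lambda>x. g x - h x" V] assms
  by (simp add: tensor_eq_def sum_subtractf)

definition tensor_linear :: "(complex, 'v) module \<Rightarrow> ('v \<Rightarrow> 'v tensor3) \<Rightarrow> bool" where
  "tensor_linear V F \<longleftrightarrow>
     (\<forall>u \<in> carrier V. \<forall>u' \<in> carrier V. tensor_eq V (F (u \<oplus>\<^bsub>V\<^esub> u')) (F u + F u')) \<and>
     (\<forall>c. \<forall>u \<in> carrier V. tensor_eq V (F (c \<odot>\<^bsub>V\<^esub> u)) (scale_tensor c (F u)))"

lemma tensor_linear_simple_tensor_1: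
  "v \<in> carrier V \<Longrightarrow> w \<in> carrier V \<Longrightarrow> tensor_linear V (\<lambda>u. simple_tensor u v w)"
  by (simp add: tensor_linear_def tensor_eq_def trilinear_rel.add1 trilinear_rel.smult1)

lemma tensor_linear_simple_tensor_2:
  "u \<in> carrier V \<Longrightarrow> w \<in> carrier V \<Longrightarrow> tensor_linear V (\<lambda>v. simple_tensor u v w)"
  by (simp add: tensor_linear_def tensor_eq_def trilinear_rel.add2 trilinear_rel.smult2)

lemma tensor_linear_simple_tensor_3:
  "u \<in> carrier V \<Longrightarrow> v \<in> carrier V \<Longrightarrow> tensor_linear V (\<lambda>w. simple_tensor u v w)"
  by (simp add: tensor_linear_def tensor_eq_def trilinear_rel.add3 trilinear_rel.smult3)

lemma tensor_rank_le_card: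
  assumes "finite I"
    and "\<And>i. i \<in> I \<Longrightarrow> u i \<in> carrier V \<and> v i \<in> carrier V \<and> w i \<in> carrier V"
    and "tensor_eq V t (\<Sum>i\<in>I. simple_tensor (u i) (v i) (w i))"
  shows "tensor_rank V t \<le> enat (card I)"
proof -
  obtain e where e: "bij_betw e {..<card I} I"
    using ex_bij_betw_nat_finite[OF \<open>finite I\<close>] by (auto simp: atLeast0LessThan)
  have "(\<Sum>i\<in>I. simple_tensor (u i) (v i) (w i)) =
      (\<Sum>k<card I. simple_tensor (u (e k)) (v (e k)) (w (e k)))"
    by (rule sum.reindex_bij_betw[OF e, symmetric])
  with assms e show ?thesis unfolding tensor_rank_def
    by (intro Inf_lower CollectI exI[of _ "card I"] conjI refl exI[of _ "u \<circ> e"]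
        exI[of _ "v \<circ> e"] exI[of _ "w \<circ> e"]) (auto simp: bij_betw_def)
qed

locale complex_module = module "class_ring :: complex ring" V
  for V :: "(complex, 'v) module" (structure)
begin

lemma complex_smult_closed: "v \<in> carrier V \<Longrightarrow> c \<odot> v \<in> carrier V"
  using smult_closed[of c v] by simp

lemma tensor_linear_finsum:
  assumes F: "tensor_linear V F" and S: "finite S" "x ` S \<subseteq> carrier V"
  shows "tensor_eq V (F (\<Oplus>a\<in>S. c a \<odot> x a)) (\<Sum>a\<in>S. scale_tensor (c a) (F (x a)))"
  using S
proof (induction S rule: finite_induct)
  case empty
  have "0 \<odot> \<zero> = \<zero>"
    using smult_r_null[of 0] by simp
  then have "tensor_eq V (F \<zero>) (scale_tensor 0 (F \<zero>))"
    using F unfolding tensor_linear_def by (metis zero_closed)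
  then show ?case by simp
next
  case (insert a S)
  let ?s = "\<Oplus>a\<in>S. c a \<odot> x a"
  have closed: "?s \<in> carrier V" "c a \<odot> x a \<in> carrier V" "x a \<in> carrier V"
    using insert.prems by (auto intro!: finsum_closed complex_smult_closed)
  have "(\<Oplus>a\<in>insert a S. c a \<odot> x a) = c a \<odot> x a \<oplus> ?s"
    using insert by (intro finsum_insert) (auto intro: complex_smult_closed)
  then have "tensor_eq V (F (\<Oplus>a\<in>insert a S. c a \<odot> x a)) (F (c a \<odot> x a) + F ?s)"
    using F closed by (simp add: tensor_linear_def)
  also have "tensor_eq V (F (c a \<odot> x a) + F ?s)
      (scale_tensor (c a) (F (x a)) + (\<Sum>a\<in>S. scale_tensor (c a) (F (x a))))"
    using F insert closed by (intro tensor_eq_add) (auto simp: tensor_linear_def)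
  finally show ?case using insert.hyps by simp
qed

lemma tensor_eq_simple_tensor_lincomb:
  assumes B: "finite B" "B \<subseteq> carrier V" and w: "w \<in> carrier V"
  shows "tensor_eq V (simple_tensor (lincomb \<alpha> B) (lincomb \<beta> B) w)
    (\<Sum>a\<in>B. \<Sum>b\<in>B. scale_tensor (\<alpha> a * \<beta> b) (simple_tensor a b w))"
proof -
  have lincomb_right: "tensor_eq V (simple_tensor a (lincomb \<beta> B) w)
      (\<Sum>b\<in>B. scale_tensor (\<beta> b) (simple_tensor a b w))" if "a \<in> B" for a
    unfolding lincomb_def using B w that
    by (intro tensor_linear_finsum tensor_linear_simple_tensor_2) auto
  have "lincomb \<beta> B \<in> carrier V"
    using B by (intro lincomb_closed) auto
  then have "tensor_eq V (simple_tensor (lincomb \<alpha> B) (lincomb \<beta> B) w)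
      (\<Sum>a\<in>B. scale_tensor (\<alpha> a) (simple_tensor a (lincomb \<beta> B) w))"
    unfolding lincomb_def[of \<alpha>] using B w
    by (intro tensor_linear_finsum[where F = "\<lambda>u. simple_tensor u _ w"]
        tensor_linear_simple_tensor_1) auto
  also have "tensor_eq V \<dots>
      (\<Sum>a\<in>B. scale_tensor (\<alpha> a) (\<Sum>b\<in>B. scale_tensor (\<beta> b) (simple_tensor a b w)))"
    by (intro tensor_eq_sum tensor_eq_scale_tensor lincomb_right)
  also have "\<dots> = (\<Sum>a\<in>B. \<Sum>b\<in>B. scale_tensor (\<alpha> a * \<beta> b) (simple_tensor a b w))"
    by (simp only: tensor.scale_sum_right tensor.scale_scale)
  finally show ?thesis .
qed

lemma tensor_rank_structure_tensor_le_card: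
  assumes B: "finite B" "B \<subseteq> carrier V" and I: "finite I" "w ` I \<subseteq> carrier V"
    and mult: "\<And>a b. a \<in> B \<Longrightarrow> b \<in> B \<Longrightarrow>
      a \<otimes>\<^bsub>V\<^esub> b = (\<Oplus>t\<in>I. (\<alpha> t a * \<beta> t b) \<odot> w t)"
  shows "tensor_rank V (structure_tensor V B) \<le> enat (card I)"
proof -
  let ?s = "\<lambda>a b t. scale_tensor (\<alpha> t a * \<beta> t b) (simple_tensor a b (w t))"
  have "tensor_eq V (simple_tensor a b (a \<otimes>\<^bsub>V\<^esub> b)) (\<Sum>t\<in>I. ?s a b t)"
    if "a \<in> B" "b \<in> B" for a b
    unfolding mult[OF that] using that B I
    by (intro tensor_linear_finsum tensor_linear_simple_tensor_3) auto
  then have "tensor_eq V (structure_tensor V B) (\<Sum>a\<in>B. \<Sum>b\<in>B. \<Sum>t\<in>I. ?s a b t)"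
    unfolding structure_tensor_def by (intro tensor_eq_sum)
  also have "(\<Sum>a\<in>B. \<Sum>b\<in>B. \<Sum>t\<in>I. ?s a b t) = (\<Sum>t\<in>I. \<Sum>a\<in>B. \<Sum>b\<in>B. ?s a b t)"
    by (simp only: sum.swap[of _ I])
  also have "tensor_eq V \<dots> (\<Sum>t\<in>I. simple_tensor (lincomb (\<alpha> t) B) (lincomb (\<beta> t) B) (w t))"
    using B I by (intro tensor_eq_sum tensor_eq_sym[OF tensor_eq_simple_tensor_lincomb]) auto
  finally show ?thesis
    using B I by (intro tensor_rank_le_card) auto
qed

end

lemma algebra_rank_le_card:
  assumes A: "vectorspace class_ring A" and fin_dim: "vectorspace.fin_dim class_ring A"
    and I: "finite I" "w ` I \<subseteq> carrier A"
    and mult: "\<And>a b. a \<in> carrier A \<Longrightarrow> b \<in> carrier A \<Longrightarrow>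
      a \<otimes>\<^bsub>A\<^esub> b = (\<Oplus>\<^bsub>A\<^esub>t\<in>I. (\<alpha> t a * \<beta> t b) \<odot>\<^bsub>A\<^esub> w t)"
  shows "algebra_rank A \<le> enat (card I)"
proof -
  interpret vectorspace class_ring A by (rule A)
  interpret complex_module A ..
  define B where "B = (SOME B. finite B \<and> basis B)"
  have "finite B \<and> basis B"
    unfolding B_def using finite_basis_exists[OF fin_dim] by (rule someI_ex)
  then have "finite B" "B \<subseteq> carrier A"
    by (auto simp: basis_def)
  then have "tensor_rank A (structure_tensor A B) \<le> enat (card I)"
    using I by (intro tensor_rank_structure_tensor_le_card[OF _ _ _ _ mult]) auto
  then show ?thesis
    by (simp add: algebra_rank_def B_def)
qed

section \<open>Interpolation\<close>

definition lagrange_basis :: "'a::field set \<Rightarrow> 'a \<Rightarrow> 'a poly" where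
  "lagrange_basis X x = (\<Prod>y\<in>X - {x}. Polynomial.smult (inverse (x - y)) [:- y, 1:])"

lemma poly_lagrange_basis:
  assumes "finite X" "z \<in> X"
  shows "poly (lagrange_basis X x) z = (if z = x then 1 else 0)"
proof -
  have "poly (lagrange_basis X x) z = (\<Prod>y\<in>X - {x}. (z - y) / (x - y))"
    by (simp add: lagrange_basis_def poly_prod divide_inverse algebra_simps)
  also have "\<dots> = (if z = x then 1 else 0)"
    using assms by (auto intro: prod.neutral)
  finally show ?thesis .
qed

lemma degree_lagrange_basis_less:
  assumes "finite X" "x \<in> X"
  shows "degree (lagrange_basis X x) < card X"
proof -
  have "degree (lagrange_basis X x) \<le> card (X - {x})"
    unfolding lagrange_basis_def using assms
    by (intro order_trans[OF degree_prod_sum_le] order_trans[OF sum_bounded_above[where K = 1]])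
      auto
  also have "\<dots> < card X"
    using assms by (rule card_Diff1_less)
  finally show ?thesis .
qed

lemma lagrange_interpolation:
  assumes "finite X" "degree u < card X"
  shows "u = (\<Sum>x\<in>X. Polynomial.smult (poly u x) (lagrange_basis X x))"
proof (rule poly_eqI_degree)
  show "poly u z = poly (\<Sum>x\<in>X. Polynomial.smult (poly u x) (lagrange_basis X x)) z"
    if "z \<in> X" for z
    using assms(1) that
    by (simp add: poly_sum poly_lagrange_basis if_distrib sum.delta cong: if_cong)
  show "degree (\<Sum>x\<in>X. Polynomial.smult (poly u x) (lagrange_basis X x)) < card X"
    using assms
    by (intro degree_sum_less le_less_trans[OF degree_smult_le] degree_lagrange_basis_less) auto
qed (rule assms(2))

section \<open>Polynomials in several variables\<close>

abbreviation mv_const :: "complex \<Rightarrow> 'n mvpoly" where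
  "mv_const c \<equiv> Poly_Mapping.single 0 c"

abbreviation mv_scale :: "complex \<Rightarrow> 'n mvpoly \<Rightarrow> 'n mvpoly" where
  "mv_scale c f \<equiv> mv_const c * f"

interpretation mvpoly: vector_space_pair
  "mv_scale :: complex \<Rightarrow> 'n mvpoly \<Rightarrow> 'n mvpoly" "mv_scale :: complex \<Rightarrow> 'm mvpoly \<Rightarrow> 'm mvpoly"
  by unfold_locales
    (simp_all add: algebra_simps single_add mult.assoc[symmetric] mult_single)

abbreviation mv_linear :: "('n mvpoly \<Rightarrow> 'm mvpoly) \<Rightarrow> bool" where
  "mv_linear \<equiv> Vector_Spaces.linear mv_scale mv_scale"

lemma mvpoly_biadditive_induct [case_names zero_left add_left zero_right add_right single]:
  fixes f g :: "'n mvpoly"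
  assumes zero_left: "\<And>g. P 0 g" and add_left: "\<And>f f' g. P f g \<Longrightarrow> P f' g \<Longrightarrow> P (f + f') g"
    and zero_right: "\<And>f. P f 0" and add_right: "\<And>f g g'. P f g \<Longrightarrow> P f g' \<Longrightarrow> P f (g + g')"
    and single: "\<And>a c b e. P (Poly_Mapping.single a c) (Poly_Mapping.single b e)"
  shows "P f g"
proof (induction f rule: mvpoly_induct)
  case (2 a c f)
  have "P (Poly_Mapping.single a c) g"
    by (induction g rule: mvpoly_induct) (auto intro: zero_right add_right single)
  with 2 show ?case by (intro add_left)
qed (rule zero_left)

definition monom_degree :: "('n::finite \<Rightarrow>\<^sub>0 nat) \<Rightarrow> nat" where
  "monom_degree m = (\<Sum>i\<in>UNIV. Poly_Mapping.lookup m i)"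

lemma monom_degree_0 [simp]: "monom_degree 0 = 0"
  by (simp add: monom_degree_def)

lemma monom_degree_add [simp]: "monom_degree (a + b) = monom_degree a + monom_degree b"
  by (simp add: monom_degree_def lookup_add sum.distrib)

lemma monom_degree_single [simp]: "monom_degree (Poly_Mapping.single i k) = k"
  by (simp add: monom_degree_def lookup_single when_def)

lemma monom_degree_eq_0_iff: "monom_degree m = 0 \<longleftrightarrow> m = 0"
  by (auto simp: monom_degree_def intro: poly_mapping_eqI)

lemma finite_monom_degree_le: "finite {m :: 'n::finite \<Rightarrow>\<^sub>0 nat. monom_degree m \<le> d}"
proof (rule finite_imageD)
  show "inj_on Poly_Mapping.lookup {m :: 'n \<Rightarrow>\<^sub>0 nat. monom_degree m \<le> d}"
    by (simp add: inj_on_def lookup_inject)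
  have "Poly_Mapping.lookup m i \<le> d" if "monom_degree m \<le> d" for m :: "'n \<Rightarrow>\<^sub>0 nat" and i
    using that member_le_sum[of i UNIV "Poly_Mapping.lookup m"] by (simp add: monom_degree_def)
  then have "Poly_Mapping.lookup ` {m :: 'n \<Rightarrow>\<^sub>0 nat. monom_degree m \<le> d} \<subseteq>
      PiE UNIV (\<lambda>_. {..d})"
    by auto
  then show "finite (Poly_Mapping.lookup ` {m :: 'n \<Rightarrow>\<^sub>0 nat. monom_degree m \<le> d})"
    by (rule finite_subset) (simp add: finite_PiE)
qed

lemma monomial_induct [case_names zero add_var]:
  fixes a :: "'n::finite \<Rightarrow>\<^sub>0 nat"
  assumes "P 0" and add_var: "\<And>i b. P b \<Longrightarrow> P (Poly_Mapping.single i 1 + b)"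
  shows "P a"
proof (induction "monom_degree a" arbitrary: a)
  case 0
  then show ?case using \<open>P 0\<close> by (simp add: monom_degree_eq_0_iff)
next
  case (Suc k)
  then have "a \<noteq> 0" by auto
  then obtain i where "Poly_Mapping.lookup a i \<noteq> 0"
    by (metis poly_mapping_eqI lookup_zero)
  then have a: "a = Poly_Mapping.single i 1 + (a - Poly_Mapping.single i 1)"
    by (intro poly_mapping_eqI) (auto simp: lookup_add lookup_minus lookup_single when_def)
  then have "k = monom_degree (a - Poly_Mapping.single i 1)"
    using Suc.hyps(2) by (metis Suc_inject monom_degree_add monom_degree_single plus_1_eq_Suc)
  then show ?case
    using add_var Suc.hyps(1) a by metis
qed

definition mv_degree :: "'n::finite mvpoly \<Rightarrow> nat" where
  "mv_degree f = Max (insert 0 (monom_degree ` Poly_Mapping.keys f))"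

lemma mv_degree_le_iff: "mv_degree f \<le> d \<longleftrightarrow> (\<forall>m \<in> Poly_Mapping.keys f. monom_degree m \<le> d)"
  by (simp add: mv_degree_def)

lemma lookup_eq_0_if_mv_degree_less:
  assumes "mv_degree f < monom_degree m"
  shows "Poly_Mapping.lookup f m = 0"
  using assms mv_degree_le_iff[of f "mv_degree f"] by (meson in_keys_iff leD order_refl)

lemma homogeneous_iff_monom_degree:
  "homogeneous d f \<longleftrightarrow> (\<forall>m \<in> Poly_Mapping.keys f. monom_degree m = d)"
  by (simp add: homogeneous_def monom_degree_def)

lemma mv_degree_le_if_homogeneous:
  assumes "homogeneous d f"
  shows "mv_degree f \<le> d"
  using assms by (simp add: mv_degree_le_iff homogeneous_iff_monom_degree)

definition mv_truncate :: "nat \<Rightarrow> 'n::finite mvpoly \<Rightarrow> 'n mvpoly" where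
  "mv_truncate d h = (\<Sum>m | monom_degree m \<le> d. Poly_Mapping.single m (Poly_Mapping.lookup h m))"

lemma lookup_mv_truncate:
  "Poly_Mapping.lookup (mv_truncate d h) m =
    (if monom_degree m \<le> d then Poly_Mapping.lookup h m else 0)"
  by (simp add: mv_truncate_def lookup_sum lookup_single when_def finite_monom_degree_le sum.delta)

lemma mv_degree_mv_truncate_le: "mv_degree (mv_truncate d h) \<le> d"
  by (auto simp: mv_degree_le_iff in_keys_iff lookup_mv_truncate split: if_splits)

definition monom_eval :: "('n::finite \<Rightarrow> 'a::comm_monoid_mult) \<Rightarrow> ('n \<Rightarrow>\<^sub>0 nat) \<Rightarrow> 'a" where
  "monom_eval p m = (\<Prod>i\<in>UNIV. p i ^ Poly_Mapping.lookup m i)"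

lemma monom_eval_0 [simp]: "monom_eval p 0 = 1"
  by (simp add: monom_eval_def)

lemma monom_eval_add: "monom_eval p (a + b) = monom_eval p a * monom_eval p b"
  by (simp add: monom_eval_def lookup_add power_add prod.distrib)

lemma monom_eval_single [simp]: "monom_eval p (Poly_Mapping.single i k) = p i ^ k"
proof -
  have "monom_eval p (Poly_Mapping.single i k) = (\<Prod>j\<in>UNIV. if j = i then p j ^ k else 1)"
    unfolding monom_eval_def by (intro prod.cong) (auto simp: lookup_single when_def)
  then show ?thesis by simp
qed

text \<open>The polynomial \<open>h (t p)\<close> in the variable \<open>t\<close>.\<close>

definition line_restriction :: "('n::finite \<Rightarrow> complex) \<Rightarrow> 'n mvpoly \<Rightarrow> complex poly" where
  "line_restriction p h = (\<Sum>m \<in> Poly_Mapping.keys h.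
     Polynomial.smult (Poly_Mapping.lookup h m) (monom (monom_eval p m) (monom_degree m)))"

lemma line_restriction_0 [simp]: "line_restriction p 0 = 0"
  by (simp add: line_restriction_def)

lemma line_restriction_add:
  "line_restriction p (g + h) = line_restriction p g + line_restriction p h"
  unfolding line_restriction_def by (rule setsum_keys_plus_distrib) (simp_all add: smult_add_left)

lemma line_restriction_single:
  "line_restriction p (Poly_Mapping.single m c) = monom (c * monom_eval p m) (monom_degree m)"
  by (simp add: line_restriction_def smult_monom)

lemma line_restriction_mult:
  "line_restriction p (g * h) = line_restriction p g * line_restriction p h"
  by (induction g h rule: mvpoly_biadditive_induct)
    (simp_all add: distrib_left distrib_right line_restriction_add line_restriction_single
      mult_single monom_eval_add mult_monom mult_ac)

lemma degree_line_restriction_le: "degree (line_restriction p h) \<le> mv_degree h"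
proof -
  have "monom_degree m \<le> mv_degree h" if "m \<in> Poly_Mapping.keys h" for m
    using that mv_degree_le_iff by blast
  then show ?thesis
    unfolding line_restriction_def smult_monom
    by (intro degree_sum_le) (auto intro: order_trans[OF degree_monom_le])
qed

section \<open>Differentiating powers of linear forms\<close>

lemma partial_add: "partial i (f + g) = partial i f + partial i g"
  by (rule poly_mapping_eqI) (simp add: lookup_partial lookup_add algebra_simps)

lemma partial_0 [simp]: "partial i 0 = 0"
  by (simp add: partial_def)

lemma partial_single:
  "partial i (Poly_Mapping.single m c) =
     Poly_Mapping.single (m - Poly_Mapping.single i 1) (of_nat (Poly_Mapping.lookup m i) * c)"
  by (cases "c = 0") (simp_all add: partial_def)

lemma partial_scale: "partial i (mv_scale c f) = mv_scale c (partial i f)"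
  by (rule poly_mapping_eqI) (simp add: lookup_partial lookup_const_mult)

lemma partial_single_mult_single:
  "partial i (Poly_Mapping.single m c) * Poly_Mapping.single k e =
    Poly_Mapping.single (m + k - Poly_Mapping.single i 1)
      (of_nat (Poly_Mapping.lookup m i) * (c * e))"
proof (cases "Poly_Mapping.lookup m i = 0")
  case False
  then have "m - Poly_Mapping.single i 1 + k = m + k - Poly_Mapping.single i 1"
    by (intro poly_mapping_eqI) (auto simp: lookup_add lookup_minus lookup_single when_def)
  then show ?thesis
    by (simp add: partial_single mult_single mult.assoc)
qed (simp add: partial_single)

lemma partial_mult: "partial i (f * g) = partial i f * g + f * partial i g"
proof (induction f g rule: mvpoly_biadditive_induct)
  case (single m c k e)
  show ?case
    unfolding partial_single_mult_single
      mult.commute[of "Poly_Mapping.single m c" "partial i (Poly_Mapping.single k e)"]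
    by (simp add: mult_single partial_single lookup_add algebra_simps single_add)
qed (simp_all add: partial_add distrib_left distrib_right)

lemma partial_power: "partial i (f ^ k) = of_nat k * f ^ (k - 1) * partial i f"
proof (induction k)
  case 0
  show ?case using partial_single[of i 0 1] by simp
next
  case (Suc k)
  have "f * (of_nat k * f ^ (k - 1)) = of_nat k * f ^ k"
    by (cases k) (simp_all add: mult_ac)
  then have "f * (of_nat k * f ^ (k - 1) * partial i f) = of_nat k * f ^ k * partial i f"
    by (simp only: mult.assoc[symmetric])
  then show ?case
    by (simp add: partial_mult Suc algebra_simps)
qed

lemma partial_linear_power:
  assumes "partial i l = mv_const c"
  shows "partial i (l ^ k) = mv_scale (of_nat k * c) (l ^ (k - 1))"
proof -
  have "of_nat k * l ^ (k - 1) * mv_const c = mv_scale (of_nat k) (mv_scale c (l ^ (k - 1)))"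
    by (simp only: single_of_nat mult_ac)
  then show ?thesis
    by (simp only: partial_power assms mvpoly.vs1.scale_scale)
qed

lemma partial_homogeneous_1:
  assumes "homogeneous 1 l"
  shows "partial i l = mv_const (Poly_Mapping.lookup l (Poly_Mapping.single i 1))"
proof (rule poly_mapping_eqI)
  fix m
  have "Poly_Mapping.lookup l (m + Poly_Mapping.single i 1) = 0" if "m \<noteq> 0"
  proof -
    have "monom_degree (m + Poly_Mapping.single i 1) \<noteq> 1"
      using that by (simp add: monom_degree_eq_0_iff)
    then show ?thesis
      using assms unfolding homogeneous_iff_monom_degree by (metis in_keys_iff)
  qed
  then show "Poly_Mapping.lookup (partial i l) m =
      Poly_Mapping.lookup (mv_const (Poly_Mapping.lookup l (Poly_Mapping.single i 1))) m"
    by (cases "m = 0") (simp_all add: lookup_partial lookup_single)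
qed

lemma fact_Suc_times_binomial: "fact (Suc k) * (d choose Suc k) = (d - k) * (fact k * (d choose k))"
proof -
  have "fact (Suc k) * (d choose Suc k) = fact k * (Suc k * (d choose Suc k))"
    by (simp add: algebra_simps)
  also have "Suc k * (d choose Suc k) = (d - k) * (d choose k)"
    by (simp only: binomial_absorption binomial_absorb_comp)
  finally show ?thesis
    by (simp only: mult.left_commute)
qed

text \<open>The operator \<open>u (d/ds)\<close> applied to \<open>s\<^sup>d\<close> and evaluated at \<open>s = l\<close>.\<close>

definition power_act :: "'n mvpoly \<Rightarrow> nat \<Rightarrow> complex poly \<Rightarrow> 'n mvpoly" where
  "power_act l d u = (\<Sum>k\<le>d. mv_scale (of_nat (fact k * (d choose k)) * coeff u k) (l ^ (d - k)))"

lemma power_act_sum_smult: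
  "power_act l d (\<Sum>x\<in>S. Polynomial.smult (c x) (u x)) =
    (\<Sum>x\<in>S. mv_scale (c x) (power_act l d (u x)))"
proof -
  have "mv_scale (e * coeff (\<Sum>x\<in>S. Polynomial.smult (c x) (u x)) k) h =
      (\<Sum>x\<in>S. mv_scale (c x) (mv_scale (e * coeff (u x) k) h))" for e k and h :: "'a mvpoly"
    by (simp only: coeff_sum coeff_smult sum_distrib_left mvpoly.vs1.scale_sum_left
        mvpoly.vs1.scale_scale mult.left_commute)
  then show ?thesis
    by (simp only: power_act_def sum_distrib_left sum.swap[of _ S])
qed

lemma power_act_monom:
  "power_act l d (monom c k) = mv_scale (of_nat (fact k * (d choose k)) * c) (l ^ (d - k))"
proof -
  have "power_act l d (monom c k) =
      (\<Sum>j\<le>d. if j = k then mv_scale (of_nat (fact k * (d choose k)) * c) (l ^ (d - k)) else 0)"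
    unfolding power_act_def by (intro sum.cong) auto
  then show ?thesis by (auto simp: binomial_eq_0)
qed

lemma partial_monom_linear_power:
  fixes l :: "'n::finite mvpoly"
  assumes "\<And>i. partial i l = mv_const (p i)"
  shows "partial_monom a (l ^ d) = power_act l d (monom (monom_eval p a) (monom_degree a))"
proof (induction a rule: monomial_induct)
  case zero
  show ?case using power_act_monom[of l d 1 0] by (simp add: partial_monom_def)
next
  case (add_var i b)
  let ?k = "monom_degree b" and ?c = "monom_eval p b"
  have "partial_monom (Poly_Mapping.single i 1 + b) (l ^ d) =
      partial i (mv_scale (of_nat (fact ?k * (d choose ?k)) * ?c) (l ^ (d - ?k)))"
    by (simp only: partial_monom_add partial_monom_single add_var power_act_monom)
  also have "\<dots> = mv_scale (of_nat ((d - ?k) * (fact ?k * (d choose ?k))) * (p i * ?c))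
      (l ^ (d - Suc ?k))"
    unfolding partial_scale partial_linear_power[OF assms] mvpoly.vs1.scale_scale
    by (simp add: mult_ac)
  also have "\<dots> = power_act l d (monom (p i * ?c) (Suc ?k))"
    by (simp only: power_act_monom fact_Suc_times_binomial)
  finally show ?case by (simp add: monom_eval_add)
qed

lemma diff_act_linear_power:
  fixes l :: "'n::finite mvpoly"
  assumes "\<And>i. partial i l = mv_const (p i)"
  shows "h \<circ>\<^sub>\<partial> (l ^ d) = power_act l d (line_restriction p h)"
  by (simp add: diff_act_def line_restriction_def power_act_sum_smult
      partial_monom_linear_power[OF assms])

lemma diff_act_mult_linear_power:
  fixes l :: "'n::finite mvpoly"
  assumes l: "\<And>i. partial i l = mv_const (p i)"
    and X: "finite X" "mv_degree g + mv_degree h < card X"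
  shows "(g * h) \<circ>\<^sub>\<partial> (l ^ d) =
    (\<Sum>x\<in>X. mv_scale (poly (line_restriction p g) x * poly (line_restriction p h) x)
      (power_act l d (lagrange_basis X x)))"
proof -
  let ?u = "line_restriction p g * line_restriction p h"
  have "degree ?u \<le> mv_degree g + mv_degree h"
    by (intro order_trans[OF degree_mult_le] add_mono degree_line_restriction_le)
  then have "?u = (\<Sum>x\<in>X. Polynomial.smult (poly ?u x) (lagrange_basis X x))"
    using X by (intro lagrange_interpolation) auto
  then have "power_act l d ?u =
      (\<Sum>x\<in>X. mv_scale (poly ?u x) (power_act l d (lagrange_basis X x)))"
    by (metis power_act_sum_smult)
  then show ?thesis
    by (simp add: diff_act_linear_power[OF l] line_restriction_mult)
qed

section \<open>The apolar algebra\<close>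

lemma partial_monom_eq_0:
  assumes "mv_degree f < monom_degree a"
  shows "partial_monom a f = 0"
  using assms
  by (intro poly_mapping_eqI) (simp add: lookup_partial_monom lookup_eq_0_if_mv_degree_less)

lemma diff_act_mv_truncate:
  assumes "mv_degree f \<le> d"
  shows "mv_truncate d h \<circ>\<^sub>\<partial> f = h \<circ>\<^sub>\<partial> f"
proof -
  have "Poly_Mapping.keys (mv_truncate d h) \<subseteq> Poly_Mapping.keys h"
    by (auto simp: in_keys_iff lookup_mv_truncate split: if_splits)
  then have "mv_truncate d h \<circ>\<^sub>\<partial> f = (\<Sum>a\<in>Poly_Mapping.keys h.
      mv_scale (Poly_Mapping.lookup (mv_truncate d h) a) (partial_monom a f))"
    by (intro diff_act_superset) auto
  also have "\<dots> = h \<circ>\<^sub>\<partial> f"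
    unfolding diff_act_def using assms
    by (intro sum.cong) (auto simp: lookup_mv_truncate partial_monom_eq_0)
  finally show ?thesis .
qed

lemma linear_diff_act_right: "mv_linear (\<lambda>f. h \<circ>\<^sub>\<partial> f)"
  by unfold_locales (simp_all add: diff_act_add_right diff_act_const_mult_right)

lemma linear_diff_act_left: "mv_linear (\<lambda>h. h \<circ>\<^sub>\<partial> f)"
  by unfold_locales
    (simp_all add: diff_act_add_left diff_act_mult diff_act_single partial_monom_def)

lemma diff_act_linear_section:
  obtains s where "mv_linear s" and "\<And>h. s (h \<circ>\<^sub>\<partial> f) \<circ>\<^sub>\<partial> f = h \<circ>\<^sub>\<partial> f"
proof -
  obtain s where "mv_linear s" and "\<forall>g \<in> range (\<lambda>h. h \<circ>\<^sub>\<partial> f). s g \<circ>\<^sub>\<partial> f = g"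
    using mvpoly.linear_exists_right_inverse_on[OF linear_diff_act_left mvpoly.vs1.subspace_UNIV]
    by metis
  then show thesis
    using that by auto
qed

definition apolar_class :: "'n mvpoly \<Rightarrow> 'n mvpoly \<Rightarrow> 'n mvpoly set" where
  "apolar_class f h = Ann f +>\<^bsub>class_ring\<^esub> h"

lemma apolar_class_closed [simp]: "apolar_class f h \<in> carrier (apolar_algebra f)"
  and apolar_class_0: "apolar_class f 0 = \<zero>\<^bsub>apolar_algebra f\<^esub>"
  and apolar_class_add:
    "apolar_class f (g + h) = apolar_class f g \<oplus>\<^bsub>apolar_algebra f\<^esub> apolar_class f h"
  and apolar_class_mult:
    "apolar_class f (g * h) = apolar_class f g \<otimes>\<^bsub>apolar_algebra f\<^esub> apolar_class f h"
  and apolar_class_scale: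
    "apolar_class f (mv_scale c h) = c \<odot>\<^bsub>apolar_algebra f\<^esub> apolar_class f h"
proof -
  interpret I: ideal "Ann f" class_ring by (rule Ann_ideal)
  interpret h: ring_hom_ring class_ring "class_ring Quot Ann f" "(+>\<^bsub>class_ring\<^esub>) (Ann f)"
    by (rule I.rcos_ring_hom_ring)
  show "apolar_class f h \<in> carrier (apolar_algebra f)"
    "apolar_class f 0 = \<zero>\<^bsub>apolar_algebra f\<^esub>"
    "apolar_class f (g + h) = apolar_class f g \<oplus>\<^bsub>apolar_algebra f\<^esub> apolar_class f h"
    "apolar_class f (g * h) = apolar_class f g \<otimes>\<^bsub>apolar_algebra f\<^esub> apolar_class f h"
    "apolar_class f (mv_scale c h) = c \<odot>\<^bsub>apolar_algebra f\<^esub> apolar_class f h"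
    using h.hom_closed[of h] h.hom_zero h.hom_add[of g h] h.hom_mult[of g h]
      h.hom_mult[of "mv_const c" h]
    by (simp_all add: apolar_class_def apolar_algebra_def Let_def)
qed

lemma apolar_class_eqI:
  assumes "g \<circ>\<^sub>\<partial> f = h \<circ>\<^sub>\<partial> f"
  shows "apolar_class f g = apolar_class f h"
proof -
  interpret I: ideal "Ann f" class_ring by (rule Ann_ideal)
  have "(g - h) \<circ>\<^sub>\<partial> f = 0"
    using diff_act_add_left[of "g - h" h f] assms by simp
  then have "g \<in> Ann f +>\<^bsub>class_ring\<^esub> h"
    unfolding a_r_coset_def' by (auto simp: Ann_def intro!: bexI[of _ "g - h"])
  then show ?thesis
    unfolding apolar_class_def using I.a_subgroup
    by (intro abelian_group.a_repr_independence[symmetric] ring.is_abelian_group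
        class_ring.ring_axioms) simp_all
qed

lemma vectorspace_apolar_algebra: "vectorspace class_ring (apolar_algebra f)"
proof -
  interpret A: algebra class_ring "apolar_algebra f" by (rule apolar_algebra_is_algebra)
  show ?thesis
    by (intro vectorspace.intro class_field.field_axioms A.module_axioms)
qed

lemma apolar_class_sum_scale:
  assumes "finite S"
  shows "apolar_class f (\<Sum>x\<in>S. mv_scale (c x) (h x)) =
    (\<Oplus>\<^bsub>apolar_algebra f\<^esub>x\<in>S. c x \<odot>\<^bsub>apolar_algebra f\<^esub> apolar_class f (h x))"
proof -
  interpret A: vectorspace class_ring "apolar_algebra f" by (rule vectorspace_apolar_algebra)
  show ?thesis using assms
    by (induction S rule: finite_induct)
      (auto simp: apolar_class_0 apolar_class_add A.finsum_insert simp flip: apolar_class_scale)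
qed

lemma carrier_apolar_algebraE:
  assumes "a \<in> carrier (apolar_algebra f)"
  obtains h where "a = apolar_class f h"
  using assms
  by (auto simp: apolar_algebra_def Let_def apolar_class_def FactRing_def A_RCOSETS_def')

lemma apolar_class_mv_truncate:
  assumes "mv_degree f \<le> d"
  shows "apolar_class f (mv_truncate d h) = apolar_class f h"
  using assms by (intro apolar_class_eqI diff_act_mv_truncate)

lemma fin_dim_apolar_algebra:
  fixes f :: "'n::finite mvpoly"
  shows "vectorspace.fin_dim class_ring (apolar_algebra f)"
proof -
  interpret A: vectorspace class_ring "apolar_algebra f" by (rule vectorspace_apolar_algebra)
  let ?low = "{m :: 'n \<Rightarrow>\<^sub>0 nat. monom_degree m \<le> mv_degree f}"
  define S where "S = (\<lambda>m. apolar_class f (Poly_Mapping.single m 1)) ` ?low"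
  have S: "finite S" "S \<subseteq> carrier (apolar_algebra f)"
    by (auto simp: S_def finite_monom_degree_le)
  interpret span: submodule class_ring "A.span S" "apolar_algebra f"
    using S by (intro A.span_is_submodule)
  have sum_in_span: "apolar_class f (\<Sum>m\<in>T. Poly_Mapping.single m (c m)) \<in> A.span S"
    if "finite T" "T \<subseteq> ?low" for T c
    using that
  proof (induction T rule: finite_induct)
    case (insert m T)
    have "apolar_class f (Poly_Mapping.single m 1) \<in> A.span S"
      using insert.prems A.in_own_span[OF S(2)] by (auto simp: S_def)
    then have "apolar_class f (mv_scale (c m) (Poly_Mapping.single m 1)) \<in> A.span S"
      unfolding apolar_class_scale by (intro span.smult_closed) simp_all
    with insert show ?case
      by (simp add: mult_single apolar_class_add span.m_closed)
  qed (simp add: apolar_class_0 span.zero_closed)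
  have "apolar_class f h \<in> A.span S" for h
    using sum_in_span[OF finite_monom_degree_le subset_refl, of "Poly_Mapping.lookup h"]
    by (simp add: apolar_class_mv_truncate flip: mv_truncate_def)
  then have "A.span S = carrier (apolar_algebra f)"
    using A.span_is_subset2[OF S(2)] by (auto elim: carrier_apolar_algebraE)
  with S show ?thesis unfolding A.fin_dim_def by blast
qed

lemma carrier_apolar_algebra_low_degreeE:
  fixes f :: "'n::finite mvpoly"
  assumes "a \<in> carrier (apolar_algebra f)"
  obtains g where "a = apolar_class f g" and "mv_degree g \<le> mv_degree f"
proof -
  obtain h where "a = apolar_class f h"
    using assms by (rule carrier_apolar_algebraE)
  then have "a = apolar_class f (mv_truncate (mv_degree f) h)"
    by (simp add: apolar_class_mv_truncate)
  then show thesis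
    using that mv_degree_mv_truncate_le by blast
qed

text \<open>The vectors \<open>v t\<close> need not lie in the image of \<open>h \<mapsto> h \<circ> f\<close>, which is isomorphic to the
  apolar algebra; a linear section of this map carries the decomposition back to the algebra.\<close>

lemma algebra_rank_apolar_algebra_le_card:
  fixes f :: "'n::finite mvpoly"
  assumes I: "finite I"
    and decomposition: "\<And>g h. mv_degree g \<le> mv_degree f \<Longrightarrow> mv_degree h \<le> mv_degree f \<Longrightarrow>
      (g * h) \<circ>\<^sub>\<partial> f = (\<Sum>t\<in>I. mv_scale (\<alpha> t g * \<beta> t h) (v t))"
  shows "algebra_rank (apolar_algebra f) \<le> enat (card I)"
proof -
  let ?A = "apolar_algebra f"
  have "\<exists>g. a = apolar_class f g \<and> mv_degree g \<le> mv_degree f" if "a \<in> carrier ?A" for a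
    using carrier_apolar_algebra_low_degreeE[OF that] by blast
  then obtain rep where rep: "a = apolar_class f (rep a)" "mv_degree (rep a) \<le> mv_degree f"
    if "a \<in> carrier ?A" for a
    by metis
  obtain s where s: "mv_linear s" and section_s: "\<And>h. s (h \<circ>\<^sub>\<partial> f) \<circ>\<^sub>\<partial> f = h \<circ>\<^sub>\<partial> f"
    using diff_act_linear_section[of f] by blast
  interpret s: Vector_Spaces.linear mv_scale mv_scale s by (rule s)
  have "a \<otimes>\<^bsub>?A\<^esub> b = (\<Oplus>\<^bsub>?A\<^esub>t\<in>I. (\<alpha> t (rep a) * \<beta> t (rep b)) \<odot>\<^bsub>?A\<^esub> apolar_class f (s (v t)))"
    if "a \<in> carrier ?A" "b \<in> carrier ?A" for a b
  proof -
    have "a \<otimes>\<^bsub>?A\<^esub> b = apolar_class f (rep a * rep b)"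
      using rep(1) that by (metis apolar_class_mult)
    also have "\<dots> = apolar_class f (s ((rep a * rep b) \<circ>\<^sub>\<partial> f))"
      by (rule apolar_class_eqI) (rule section_s[symmetric])
    also have "\<dots> = apolar_class f (\<Sum>t\<in>I. mv_scale (\<alpha> t (rep a) * \<beta> t (rep b)) (s (v t)))"
      using rep(2) that by (simp only: decomposition s.sum s.scale)
    finally show ?thesis
      using I by (simp only: apolar_class_sum_scale)
  qed
  then show ?thesis
    using I by (intro algebra_rank_le_card[where w = "\<lambda>t. apolar_class f (s (v t))"]
        vectorspace_apolar_algebra fin_dim_apolar_algebra) auto
qed

section \<open>Waring decompositions\<close>

lemma algebra_rank_apolar_algebra_le_sum_powers:
  fixes f :: "'n::finite mvpoly" and l :: "'j \<Rightarrow> 'n mvpoly"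
  assumes J: "finite J" and l: "\<And>j. j \<in> J \<Longrightarrow> homogeneous 1 (l j)"
    and f: "f = (\<Sum>j\<in>J. mv_scale (c j) (l j ^ e j))"
  shows "algebra_rank (apolar_algebra f) \<le> enat ((2 * mv_degree f + 1) * card J)"
proof -
  define X where "X = (of_nat ` {..2 * mv_degree f} :: complex set)"
  have X: "finite X" "card X = 2 * mv_degree f + 1"
    by (simp_all add: X_def card_image inj_on_def)
  define p where "p j i = Poly_Mapping.lookup (l j) (Poly_Mapping.single i 1)" for j i
  have grad: "partial i (l j) = mv_const (p j i)" if "j \<in> J" for i j
    unfolding p_def using l[OF that] by (rule partial_homogeneous_1)
  define \<alpha> where "\<alpha> = (\<lambda>(j, x) h. poly (line_restriction (p j) h) x)"
  define v where "v = (\<lambda>(j, x). mv_scale (c j) (power_act (l j) (e j) (lagrange_basis X x)))"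
  have "(g * h) \<circ>\<^sub>\<partial> f = (\<Sum>t\<in>J \<times> X. mv_scale (\<alpha> t g * \<alpha> t h) (v t))"
    if "mv_degree g \<le> mv_degree f" "mv_degree h \<le> mv_degree f" for g h
  proof -
    interpret act: Vector_Spaces.linear mv_scale mv_scale "\<lambda>f. (g * h) \<circ>\<^sub>\<partial> f"
      by (rule linear_diff_act_right)
    have "(g * h) \<circ>\<^sub>\<partial> (l j ^ e j) = (\<Sum>x\<in>X. mv_scale (\<alpha> (j, x) g * \<alpha> (j, x) h)
        (power_act (l j) (e j) (lagrange_basis X x)))" if "j \<in> J" for j
      unfolding \<alpha>_def prod.case
      using X grad[OF that] \<open>mv_degree g \<le> mv_degree f\<close> \<open>mv_degree h \<le> mv_degree f\<close>
      by (intro diff_act_mult_linear_power) auto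
    then have "(g * h) \<circ>\<^sub>\<partial> f = (\<Sum>j\<in>J. \<Sum>x\<in>X. mv_scale (\<alpha> (j, x) g * \<alpha> (j, x) h) (v (j, x)))"
      by (subst f) (simp add: act.sum act.scale v_def sum_distrib_left mult.left_commute)
    then show ?thesis
      by (simp add: sum.cartesian_product)
  qed
  then have "algebra_rank (apolar_algebra f) \<le> enat (card (J \<times> X))"
    using J X by (intro algebra_rank_apolar_algebra_le_card) auto
  then show ?thesis
    by (simp add: card_cartesian_product X mult.commute)
qed

lemma waring_decompositionE:
  fixes f :: "'n::finite mvpoly"
  assumes "waring_rank d f = enat r"
  obtains c :: "nat \<Rightarrow> complex" and l :: "nat \<Rightarrow> 'n mvpoly"
  where "\<And>i. i < r \<Longrightarrow> homogeneous 1 (l i)" and "f = (\<Sum>i<r. mv_scale (c i) (l i ^ d))"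
proof -
  let ?R = "{enat r | r. \<exists>(c :: nat \<Rightarrow> complex) (l :: nat \<Rightarrow> 'n mvpoly).
     (\<forall>i<r. homogeneous 1 (l i)) \<and> f = (\<Sum>i<r. mv_scale (c i) (l i ^ d))}"
  have "Inf ?R = enat r"
    using assms by (simp only: waring_rank_def)
  then have "enat r \<in> ?R"
    unfolding Inf_enat_def by (metis (mono_tags, lifting) LeastI ex_in_conv enat.distinct(1))
  then show thesis
    using that by auto
qed

lemma algebra_rank_apolar_algebra_le_waring_rank:
  fixes f :: "'n::finite mvpoly"
  assumes "homogeneous d f"
  shows "algebra_rank (apolar_algebra f) \<le> enat (2 * d + 1) * waring_rank d f"
proof (cases "waring_rank d f")
  case (enat r)
  then obtain c l where "\<And>i. i < r \<Longrightarrow> homogeneous 1 (l i)"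
    and "f = (\<Sum>i<r. mv_scale (c i) (l i ^ d))"
    using waring_decompositionE by blast
  then have "algebra_rank (apolar_algebra f) \<le> enat ((2 * mv_degree f + 1) * card {..<r})"
    by (intro algebra_rank_apolar_algebra_le_sum_powers) auto
  also have "\<dots> \<le> enat (2 * d + 1) * waring_rank d f"
    using mv_degree_le_if_homogeneous[OF assms] by (simp add: enat)
  finally show ?thesis .
qed simp

theorem theorem3:
  fixes f :: "'n::finite mvpoly" and d :: nat
  assumes "homogeneous d f"
  shows "algebra_rank (apolar_algebra f) \<le> enat (3 * d + 1) * waring_rank d f"
proof -
  have "algebra_rank (apolar_algebra f) \<le> enat (2 * d + 1) * waring_rank d f"
    using assms by (rule algebra_rank_apolar_algebra_le_waring_rank)
  also have "\<dots> \<le> enat (3 * d + 1) * waring_rank d f"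
    by (intro mult_right_mono) simp_all
  finally show ?thesis .
qed

end
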